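(* Let $k,l\in\mathbb{N}$, $n\in\mathbb{N}_0$, $a_i,c_i,d_i,f_i\in\mathbb{N}$, $b_i,e_i\in\mathbb{N}_0$ and $x_i,y_i\in\mathbb{R}\setminus\{0\}$. Write $A(i)=S_{(a_1,b_1,c_1),\dots,(a_k,b_k,c_k)}(x_1,\dots,x_k;i)$, $\bar A(i)=S_{(a_2,b_2,c_2),\dots,(a_k,b_k,c_k)}(x_2,\dots,x_k;i)$, $D(i)=S_{(d_1,e_1,f_1),\dots,(d_l,e_l,f_l)}(y_1,\dots,y_l;i)$ and $\bar D(i)=S_{(d_2,e_2,f_2),\dots,(d_l,e_l,f_l)}(y_2,\dots,y_l;i)$. If $a_1e_1\ne d_1b_1$, then $$\begin{aligned}A(n)D(n)=&\sum_{i=1}^n\frac{x_1^i\,\bar A(i)D(i)}{(a_1i+b_1)^{c_1}}+\sum_{i=1}^n\frac{y_1^i\,A(i)\bar D(i)}{(d_1i+e_1)^{f_1}}\\&-\sum_{i=1}^n (x_1y_1)^i\Bigg((-1)^{c_1}\sum_{j=1}^{c_1}(-1)^j\binom{c_1+f_1-j-1}{f_1-1}\frac{a_1^{f_1}d_1^{c_1-j}}{(a_1e_1-d_1b_1)^{c_1+f_1-j}}\frac{1}{(a_1i+b_1)^j}\\&\qquad+(-1)^{f_1}\sum_{j=1}^{f_1}(-1)^j\binom{c_1+f_1-j-1}{c_1-1}\frac{a_1^{f_1-j}d_1^{c_1}}{(d_1b_1-a_1e_1)^{c_1+f_1-j}}\frac{1}{(d_1i+e_1)^j}\Bigg)\bar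 A(i)\bar D(i).\end{aligned}$$ If $a_1e_1=d_1b_1$, then $$A(n)D(n)=\sum_{i=1}^n\frac{x_1^i\,\bar A(i)D(i)}{(a_1i+b_1)^{c_1}}+\sum_{i=1}^n\frac{y_1^i\,A(i)\bar D(i)}{(d_1i+e_1)^{f_1}}-\frac{a_1^{f_1}}{d_1^{f_1}}\sum_{i=1}^n\frac{x_1^iy_1^i\,\bar A(i)\bar D(i)}{(a_1i+b_1)^{c_1+f_1}}.$$
   Context: Cyclotomic S-sums: for $a_i,c_i\in\mathbb{N}=\{1,2,\dots\}$, $b_i\in\mathbb{N}_0$, $x_i\in\mathbb{R}\setminus\{0\}$, $$S_{(a_1,b_1,c_1),\dots,(a_k,b_k,c_k)}(x_1,\dots,x_k;n)=\sum_{n\ge i_1\ge\cdots\ge i_k\ge1}\frac{x_1^{i_1}}{(a_1i_1+b_1)^{c_1}}\cdots\frac{x_k^{i_k}}{(a_ki_k+b_k)^{c_k}},$$ and the sum with empty index list equals $1$. *)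

theory Defs
  imports Complex_Main
begin

definition index_tuples :: "nat \<Rightarrow> nat \<Rightarrow> nat list set" where
  "index_tuples k n = {is. length is = k \<and> set is \<subseteq> {1..n} \<and> sorted_wrt (\<ge>) is}"

text \<open>
  The cyclotomic S-sum for the index list \<open>[(a1, b1, c1), \<dots>, (ak, bk, ck)]\<close> with weights
  \<open>[x1, \<dots>, xk]\<close>; only used when both lists have the same length.  List positions count from 0.
\<close>

definition cyclotomic_S :: "(nat \<times> nat \<times> nat) list \<Rightarrow> real list \<Rightarrow> nat \<Rightarrow> real" where
  "cyclotomic_S abc xs n =
     (\<Sum>is \<in> index_tuples (length abc) n.
        \<Prod>r < length abc. case abc ! r of (a, b, c) \<Rightarrow>
          (xs ! r) ^ (is ! r) / (real a * real (is ! r) + real b) ^ c)"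

lemma finite_index_tuples: "finite (index_tuples k n)"
proof (rule finite_subset)
  show "index_tuples k n \<subseteq> {is. set is \<subseteq> {1..n} \<and> length is = k}"
    by (auto simp: index_tuples_def)
  show "finite {is. set is \<subseteq> {1..n} \<and> length is = k}"
    by (rule finite_lists_length_eq) simp
qed

lemma cyclotomic_S_Nil: "cyclotomic_S [] [] n = 1"
proof -
  have "index_tuples 0 n = {[]}"
    by (auto simp: index_tuples_def)
  then show ?thesis
    by (simp add: cyclotomic_S_def)
qed

end

theory Submission
  imports Defs
begin

(* As functions of n, the sums A and D have first differences alpha(n) = x^n A'(n) / u^c and
   delta(n) = y^n D'(n) / v^f, where u = a n + b and v = d n + e.  Hence summation by parts gives
   A(n) D(n) = sum alpha D + sum A delta - sum alpha delta.  The last sum contains the factor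
   1 / (u^c v^f), which is split by partial fractions: a v - d u = a e - d b does not depend on n.
   If this constant vanishes, u and v are proportional. *)

text \<open>The tuples decrease weakly, so the first entry \<open>i\<close> bounds all later ones
  and the tail is a tuple with upper limit \<open>i\<close> instead of \<open>n\<close>.\<close>

lemma index_tuples_Suc:
  "index_tuples (Suc k) n = (\<Union>i\<in>{1..n}. (#) i ` index_tuples k i)"
proof (intro set_eqI iffI)
  fix js assume "js \<in> index_tuples (Suc k) n"
  then obtain i js' where "js = i # js'" and "js' \<in> index_tuples k i" and "i \<in> {1..n}"
    by (cases js) (fastforce simp: index_tuples_def)+
  then show "js \<in> (\<Union>i\<in>{1..n}. (#) i ` index_tuples k i)"
    by blast
qed (fastforce simp: index_tuples_def)

text \<open>Tuples with different heads differ, so the sum splits over the outermost index, and its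
  factor comes out of the product. This exhibits the first difference in \<open>n\<close>.\<close>

lemma cyclotomic_S_Cons:
  "cyclotomic_S ((a, b, c) # abc) (x # xs) n =
     (\<Sum>i=1..n. x ^ i / (real a * real i + real b) ^ c * cyclotomic_S abc xs i)"
proof -
  have "cyclotomic_S ((a, b, c) # abc) (x # xs) n =
      (\<Sum>i=1..n. \<Sum>js\<in>(#) i ` index_tuples (length abc) i.
        \<Prod>r<Suc (length abc). case ((a, b, c) # abc) ! r of (a, b, c) \<Rightarrow>
          ((x # xs) ! r) ^ (js ! r) / (real a * real (js ! r) + real b) ^ c)"
    unfolding cyclotomic_S_def length_Cons index_tuples_Suc
    by (rule sum.UNION_disjoint) (auto simp: finite_index_tuples)
  then show ?thesis
    by (simp add: cyclotomic_S_def sum.reindex prod.lessThan_Suc_shift sum_distrib_left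
        del: prod.lessThan_Suc)
qed

text \<open>The square of index pairs is covered by the two triangles on either side of the
  diagonal. Both contain the diagonal, which is therefore subtracted once.\<close>

lemma sum_times_sum_by_parts:
  fixes \<alpha> \<delta> :: "nat \<Rightarrow> real"
  shows "(\<Sum>i=1..n. \<alpha> i) * (\<Sum>i=1..n. \<delta> i) =
    (\<Sum>i=1..n. \<alpha> i * (\<Sum>j=1..i. \<delta> j)) + (\<Sum>i=1..n. \<delta> i * (\<Sum>j=1..i. \<alpha> j))
    - (\<Sum>i=1..n. \<alpha> i * \<delta> i)"
  by (induction n) (simp_all add: algebra_simps)

text \<open>
  The principal part at the pole \<open>U = 0\<close> of \<open>1 / (U ^ c * V ^ Suc g)\<close> with \<open>V = U + \<Delta>\<close>,
  where \<open>p = 1 / U\<close> and \<open>w = 1 / \<Delta>\<close>.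
\<close>

definition principal_part :: "real \<Rightarrow> real \<Rightarrow> nat \<Rightarrow> nat \<Rightarrow> real" where
  "principal_part w p c g =
     (\<Sum>m<c. (-1) ^ m * real ((m + g) choose g) * w ^ (m + g + 1) * p ^ (c - m))"

lemma principal_part_0 [simp]: "principal_part w p 0 g = 0"
  by (simp add: principal_part_def)

lemma principal_part_1 [simp]: "principal_part w p (Suc 0) g = w ^ Suc g * p"
  by (simp add: principal_part_def)

lemma principal_part_Suc_0:
  "principal_part w p (Suc c) 0 = w * p ^ Suc c - w * principal_part w p c 0"
  unfolding principal_part_def sum.lessThan_Suc_shift
  by (simp add: sum_distrib_left sum_negf algebra_simps)

text \<open>Pascal's rule splits each binomial coefficient; the second half vanishes at
  \<open>m = 0\<close> and is shifted by one. With q = 1 / V, the recursion mirrors what p * q = w *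
  (p - q) gives for p ^ c * q ^ (g + 1).\<close>

lemma principal_part_Suc_Suc:
  "principal_part w p (Suc c) (Suc g) =
     w * principal_part w p (Suc c) g - w * principal_part w p c (Suc g)"
  unfolding principal_part_def sum.lessThan_Suc_shift
  by (simp add: sum_distrib_left sum_negf sum.distrib sum_subtractf algebra_simps)

text \<open>The assumption is 1 / U - 1 / V = \<Delta> / (U * V) in terms of the reciprocals. Here
  the pole at V = 0 is simple, so its principal part is a single term, multiplied by -w in each
  induction step.\<close>

lemma principal_part_sum_0:
  assumes "p * q = w * (p - q)"
  shows "principal_part w p (Suc h) 0 + principal_part (- w) q (Suc 0) h = p ^ Suc h * q"
proof (induction h)
  case 0
  then show ?case using assms by (simp add: algebra_simps)
next
  case (Suc h)
  have "principal_part w p (Suc (Suc h)) 0 + principal_part (- w) q (Suc 0) (Suc h)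
      = w * p ^ Suc (Suc h) - w * (p ^ Suc h * q)"
    \<comment> \<open>The induction hypothesis is read from right to left:
      \<open>p ^ Suc h * q\<close> becomes the two principal parts that the recursion leaves with
      factor -w.\<close>
    unfolding principal_part_Suc_0[of w p "Suc h"] Suc.IH[symmetric]
    by (simp add: algebra_simps)
  also have "\<dots> = p ^ Suc h * (p * q)"
    unfolding assms by (simp add: algebra_simps)
  also have "\<dots> = p ^ Suc (Suc h) * q"
    by simp
  finally show ?case .
qed

text \<open>Both sides obey the same recursion, which lowers one of the two exponents, so induction
  on \<open>h + g\<close> reduces to the cases with a simple pole.\<close>

lemma principal_part_sum:
  assumes "p * q = w * (p - q)"
  shows "principal_part w p (Suc h) g + principal_part (- w) q (Suc g) h
    = p ^ Suc h * q ^ Suc g"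
proof (induction "h + g" arbitrary: h g)
  case 0
  then show ?case using principal_part_sum_0[OF assms, of 0] by simp
next
  case (Suc N)
  \<comment> \<open>Exchanging the two poles negates w; this turns the case \<open>h = 0\<close>
    into the case \<open>g = 0\<close>.\<close>
  have swap: "q * p = - w * (q - p)"
    using assms by (simp add: algebra_simps)
  consider "g = 0" | "h = 0" | h' g' where "h = Suc h'" "g = Suc g'"
    by (metis not0_implies_Suc)
  then show ?case
  proof cases
    case 1
    then show ?thesis using principal_part_sum_0[OF assms, of h] by simp
  next
    case 2
    then show ?thesis using principal_part_sum_0[OF swap, of g] by (simp add: algebra_simps)
  next
    case 3
    have "principal_part w p (Suc h) g + principal_part (- w) q (Suc g) h
        = w * (principal_part w p (Suc h) g' + principal_part (- w) q (Suc g') h)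
          - w * (principal_part w p (Suc h') g + principal_part (- w) q (Suc g) h')"
      unfolding 3 principal_part_Suc_Suc[of _ _ "Suc h'"] principal_part_Suc_Suc[of _ _ "Suc g'"]
      by (simp add: algebra_simps)
    also have "\<dots> = w * (p ^ Suc h * q ^ Suc g') - w * (p ^ Suc h' * q ^ Suc g)"
      using Suc.hyps 3 by simp
    also have "\<dots> = p ^ h * q ^ g * (p * q)"
      unfolding 3 assms by (simp add: algebra_simps)
    also have "\<dots> = p ^ Suc h * q ^ Suc g"
      by simp
    finally show ?thesis .
  qed
qed

text \<open>Translation to the form in the theorem: U = d * u, and the summation index is reversed
  by m = c - j. The factor d ^ c * a ^ f undoes the rescaling of both linear forms.\<close>

lemma principal_part_eq_sum:
  fixes a d u \<Delta> :: real
  assumes "d \<noteq> 0" and "1 \<le> f"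
  shows "(-1) ^ c * (\<Sum>j=1..c. (-1) ^ j * real ((c + f - j - 1) choose (f - 1))
        * (a ^ f * d ^ (c - j) / \<Delta> ^ (c + f - j)) * (1 / u ^ j))
    = d ^ c * a ^ f * principal_part (1 / \<Delta>) (1 / (d * u)) c (f - 1)"
proof -
  have "(-1) ^ c * (\<Sum>j=1..c. (-1) ^ j * real ((c + f - j - 1) choose (f - 1))
        * (a ^ f * d ^ (c - j) / \<Delta> ^ (c + f - j)) * (1 / u ^ j))
    = (\<Sum>j=1..c. d ^ c * a ^ f * ((-1) ^ (c - j) * real ((c - j + (f - 1)) choose (f - 1))
        * (1 / \<Delta>) ^ (c - j + (f - 1) + 1) * (1 / (d * u)) ^ (c - (c - j))))"
    unfolding sum_distrib_left
  proof (rule sum.cong[OF refl])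
    fix j assume "j \<in> {1..c}"
    then obtain m where c: "c = m + j" by (metis atLeastAtMost_iff le_add_diff_inverse2)
    obtain g where f: "f = Suc g" using assms(2) by (cases f) auto
    have "(-1::real) ^ j * (-1) ^ j = 1" by (simp flip: power_add)
    then show "(-1) ^ c * ((-1) ^ j * real ((c + f - j - 1) choose (f - 1))
        * (a ^ f * d ^ (c - j) / \<Delta> ^ (c + f - j)) * (1 / u ^ j))
      = d ^ c * a ^ f * ((-1) ^ (c - j) * real ((c - j + (f - 1)) choose (f - 1))
        * (1 / \<Delta>) ^ (c - j + (f - 1) + 1) * (1 / (d * u)) ^ (c - (c - j)))"
      using assms(1)
      by (simp add: c f power_add power_mult_distrib power_divide mult_ac)
  qed
  also have "\<dots> = d ^ c * a ^ f * principal_part (1 / \<Delta>) (1 / (d * u)) c (f - 1)"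
    unfolding principal_part_def sum_distrib_left
    by (rule sum.reindex_bij_witness[of _ "\<lambda>m. c - m" "\<lambda>j. c - j"]) auto
  finally show ?thesis .
qed

text \<open>After rescaling to U = d * u and V = a * v, the difference V - U is \<Delta>, so
  \<open>principal_part_sum\<close> applies.\<close>

lemma partial_fractions_two_linear_powers:
  fixes a d u v \<Delta> :: real
  assumes "a \<noteq> 0" "d \<noteq> 0" "u \<noteq> 0" "v \<noteq> 0" "\<Delta> \<noteq> 0" and \<Delta>: "a * v - d * u = \<Delta>"
    and "1 \<le> c" "1 \<le> f"
  shows "(-1) ^ c * (\<Sum>j=1..c. (-1) ^ j * real ((c + f - j - 1) choose (f - 1))
        * (a ^ f * d ^ (c - j) / \<Delta> ^ (c + f - j)) * (1 / u ^ j))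
    + (-1) ^ f * (\<Sum>j=1..f. (-1) ^ j * real ((c + f - j - 1) choose (c - 1))
        * (a ^ (f - j) * d ^ c / (- \<Delta>) ^ (c + f - j)) * (1 / v ^ j))
    = 1 / (u ^ c * v ^ f)"
proof -
  let ?p = "1 / (d * u)" and ?q = "1 / (a * v)" and ?w = "1 / \<Delta>"
  have pq: "?p * ?q = ?w * (?p - ?q)"
  proof -
    have "?p - ?q = \<Delta> / (d * u * (a * v))"
      using assms(1-4) by (simp add: \<Delta>[symmetric] diff_frac_eq)
    then show ?thesis using \<open>\<Delta> \<noteq> 0\<close> by simp
  qed
  obtain h g where cf: "c = Suc h" "f = Suc g"
    using assms(7,8) by (metis One_nat_def Suc_le_D)
  have "d ^ c * a ^ f * (principal_part ?w ?p c (f - 1) + principal_part (- ?w) ?q f (c - 1))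
      = d ^ c * a ^ f * (?p ^ c * ?q ^ f)"
    using principal_part_sum[OF pq, of h g] by (simp add: cf)
  also have "\<dots> = 1 / (u ^ c * v ^ f)"
    using assms(1,2) by (simp add: power_divide power_mult_distrib)
  finally show ?thesis
    \<comment> \<open>The second instance exchanges the two linear forms together with their
      exponents, which turns \<Delta> into -\<Delta>.\<close>
    using principal_part_eq_sum[of d f c a \<Delta> u] principal_part_eq_sum[of a c f d "- \<Delta>" v] assms
    by (simp add: algebra_simps)
qed

theorem theorem5p1p2:
  fixes k l n :: nat
    and a b c d e f :: "nat \<Rightarrow> nat"
    and x y :: "nat \<Rightarrow> real"
    and A A' D D' :: "nat \<Rightarrow> real"
  assumes "k \<ge> 1" and "l \<ge> 1"
    and "\<forall>r\<in>{1..k}. a r \<ge> 1 \<and> c r \<ge> 1 \<and> x r \<noteq> 0"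
    and "\<forall>r\<in>{1..l}. d r \<ge> 1 \<and> f r \<ge> 1 \<and> y r \<noteq> 0"
  defines "A \<equiv> cyclotomic_S (map (\<lambda>r. (a r, b r, c r)) [1..<Suc k]) (map x [1..<Suc k])"
    and "A' \<equiv> cyclotomic_S (map (\<lambda>r. (a r, b r, c r)) [2..<Suc k]) (map x [2..<Suc k])"
    and "D \<equiv> cyclotomic_S (map (\<lambda>r. (d r, e r, f r)) [1..<Suc l]) (map y [1..<Suc l])"
    and "D' \<equiv> cyclotomic_S (map (\<lambda>r. (d r, e r, f r)) [2..<Suc l]) (map y [2..<Suc l])"
  shows
    "(a 1 * e 1 \<noteq> d 1 * b 1 \<longrightarrow>
       A n * D n =
         (\<Sum>i=1..n. x 1 ^ i * A' i * D i / (real (a 1) * real i + real (b 1)) ^ c 1)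
       + (\<Sum>i=1..n. y 1 ^ i * A i * D' i / (real (d 1) * real i + real (e 1)) ^ f 1)
       - (\<Sum>i=1..n. (x 1 * y 1) ^ i *
            ((-1) ^ c 1 * (\<Sum>j=1..c 1. (-1) ^ j * real ((c 1 + f 1 - j - 1) choose (f 1 - 1))
                * (real (a 1) ^ f 1 * real (d 1) ^ (c 1 - j)
                    / (real (a 1) * real (e 1) - real (d 1) * real (b 1)) ^ (c 1 + f 1 - j))
                * (1 / (real (a 1) * real i + real (b 1)) ^ j))
           + (-1) ^ f 1 * (\<Sum>j=1..f 1. (-1) ^ j * real ((c 1 + f 1 - j - 1) choose (c 1 - 1))
                * (real (a 1) ^ (f 1 - j) * real (d 1) ^ c 1
                    / (real (d 1) * real (b 1) - real (a 1) * real (e 1)) ^ (c 1 + f 1 - j))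
                * (1 / (real (d 1) * real i + real (e 1)) ^ j)))
            * A' i * D' i))
     \<and>
     (a 1 * e 1 = d 1 * b 1 \<longrightarrow>
       A n * D n =
         (\<Sum>i=1..n. x 1 ^ i * A' i * D i / (real (a 1) * real i + real (b 1)) ^ c 1)
       + (\<Sum>i=1..n. y 1 ^ i * A i * D' i / (real (d 1) * real i + real (e 1)) ^ f 1)
       - real (a 1) ^ f 1 / real (d 1) ^ f 1 *
         (\<Sum>i=1..n. x 1 ^ i * y 1 ^ i * A' i * D' i
            / (real (a 1) * real i + real (b 1)) ^ (c 1 + f 1)))"
proof -
  define u v where "u = (\<lambda>i::nat. real (a 1) * real i + real (b 1))"
    and "v = (\<lambda>i::nat. real (d 1) * real i + real (e 1))"
  define \<alpha> \<delta> where "\<alpha> = (\<lambda>i. x 1 ^ i / u i ^ c 1 * A' i)"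
    and "\<delta> = (\<lambda>i. y 1 ^ i / v i ^ f 1 * D' i)"
  have pos: "a 1 \<ge> 1" "c 1 \<ge> 1" "d 1 \<ge> 1" "f 1 \<ge> 1"
    using assms(1-4) by auto
  have A: "A m = (\<Sum>i=1..m. \<alpha> i)" for m
    using \<open>k \<ge> 1\<close> unfolding A_def A'_def \<alpha>_def u_def
    by (simp add: upt_conv_Cons cyclotomic_S_Cons numeral_2_eq_2 del: upt_Suc)
  have D: "D m = (\<Sum>i=1..m. \<delta> i)" for m
    using \<open>l \<ge> 1\<close> unfolding D_def D'_def \<delta>_def v_def
    by (simp add: upt_conv_Cons cyclotomic_S_Cons numeral_2_eq_2 del: upt_Suc)
  have parts: "A n * D n = (\<Sum>i=1..n. x 1 ^ i * A' i * D i / u i ^ c 1)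
      + (\<Sum>i=1..n. y 1 ^ i * A i * D' i / v i ^ f 1) - (\<Sum>i=1..n. \<alpha> i * \<delta> i)"
  proof -
    have "A n * D n = (\<Sum>i=1..n. \<alpha> i * D i) + (\<Sum>i=1..n. \<delta> i * A i) - (\<Sum>i=1..n. \<alpha> i * \<delta> i)"
      unfolding A D by (rule sum_times_sum_by_parts)
    then show ?thesis by (simp add: \<alpha>_def \<delta>_def mult_ac)
  qed
  \<comment> \<open>The index starts at 1, so both forms are positive even when \<open>b 1\<close>
    or \<open>e 1\<close> is 0.\<close>
  have uv: "u i > 0" "v i > 0" if "i \<in> {1..n}" for i
    using that pos by (auto simp: u_def v_def add_pos_nonneg)
  show ?thesis
  proof (intro conjI impI)
    assume "a 1 * e 1 \<noteq> d 1 * b 1"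
    then have ne: "real (a 1) * real (e 1) - real (d 1) * real (b 1) \<noteq> 0"
      by (metis eq_iff_diff_eq_0 of_nat_eq_iff of_nat_mult)
    show "A n * D n =
         (\<Sum>i=1..n. x 1 ^ i * A' i * D i / (real (a 1) * real i + real (b 1)) ^ c 1)
       + (\<Sum>i=1..n. y 1 ^ i * A i * D' i / (real (d 1) * real i + real (e 1)) ^ f 1)
       - (\<Sum>i=1..n. (x 1 * y 1) ^ i *
            ((-1) ^ c 1 * (\<Sum>j=1..c 1. (-1) ^ j * real ((c 1 + f 1 - j - 1) choose (f 1 - 1))
                * (real (a 1) ^ f 1 * real (d 1) ^ (c 1 - j)
                    / (real (a 1) * real (e 1) - real (d 1) * real (b 1)) ^ (c 1 + f 1 - j))
                * (1 / (real (a 1) * real i + real (b 1)) ^ j))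
           + (-1) ^ f 1 * (\<Sum>j=1..f 1. (-1) ^ j * real ((c 1 + f 1 - j - 1) choose (c 1 - 1))
                * (real (a 1) ^ (f 1 - j) * real (d 1) ^ c 1
                    / (real (d 1) * real (b 1) - real (a 1) * real (e 1)) ^ (c 1 + f 1 - j))
                * (1 / (real (d 1) * real i + real (e 1)) ^ j)))
            * A' i * D' i)" (is "_ = _ + _ - (\<Sum>i=1..n. _ * ?pf i * _ * _)")
    proof -
      have "\<alpha> i * \<delta> i = (x 1 * y 1) ^ i * ?pf i * A' i * D' i" if i: "i \<in> {1..n}" for i
      proof -
        \<comment> \<open>The terms linear in i cancel in a 1 * v i - d 1 * u i, so \<Delta> is the
          nonzero constant from \<open>ne\<close>.\<close>
        have "?pf i = 1 / (u i ^ c 1 * v i ^ f 1)"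
          using partial_fractions_two_linear_powers[of "a 1" "d 1" "u i" "v i", OF _ _ _ _ ne]
            uv[OF i] pos
          by (simp add: u_def v_def algebra_simps)
        then show ?thesis by (simp add: \<alpha>_def \<delta>_def power_mult_distrib)
      qed
      then show ?thesis
        unfolding parts by (simp add: u_def v_def)
    qed
  next
    assume eq: "a 1 * e 1 = d 1 * b 1"
    have "\<alpha> i * \<delta> i = real (a 1) ^ f 1 / real (d 1) ^ f 1 *
        (x 1 ^ i * y 1 ^ i * A' i * D' i / u i ^ (c 1 + f 1))" if i: "i \<in> {1..n}" for i
    proof -
      \<comment> \<open>The same difference is now 0, so every power of 1 / v i becomes a power of 1
        / u i.\<close>
      have "real (a 1) * v i = real (d 1) * u i"
        using arg_cong[OF eq, of real] by (simp add: u_def v_def algebra_simps)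
      then have "1 / v i = real (a 1) / (real (d 1) * u i)"
        using uv[OF i] pos by (simp add: field_simps)
      then have "1 / v i ^ f 1 = real (a 1) ^ f 1 / (real (d 1) ^ f 1 * u i ^ f 1)"
        by (metis power_divide power_mult_distrib power_one)
      then have "x 1 ^ i / u i ^ c 1 * A' i * (y 1 ^ i * D' i * (1 / v i ^ f 1)) =
          real (a 1) ^ f 1 / real (d 1) ^ f 1 *
          (x 1 ^ i * y 1 ^ i * A' i * D' i / u i ^ (c 1 + f 1))"
        by (simp only: power_add) (simp add: mult_ac)
      then show ?thesis by (simp add: \<alpha>_def \<delta>_def)
    qed
    then show "A n * D n =
         (\<Sum>i=1..n. x 1 ^ i * A' i * D i / (real (a 1) * real i + real (b 1)) ^ c 1)
       + (\<Sum>i=1..n. y 1 ^ i * A i * D' i / (real (d 1) * real i + real (e 1)) ^ f 1)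
       - real (a 1) ^ f 1 / real (d 1) ^ f 1 *
         (\<Sum>i=1..n. x 1 ^ i * y 1 ^ i * A' i * D' i
            / (real (a 1) * real i + real (b 1)) ^ (c 1 + f 1))"
      unfolding parts by (simp add: u_def v_def sum_distrib_left)
  qed
qed

end
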